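(* Let $\alpha,\beta\in(0,\infty]$ and let $a:=\alpha^{-1}$, $b:=\beta^{-1}$ (with $\infty^{-1}=0$). Let $n\ge1$ (with $n\ge2$ if $\alpha=\beta=\infty$). The probability that the $i$:th diagonal box of the random $\alpha/\beta$-staircase tableau $S_{n,\alpha,\beta}$ contains $\alpha$ is $$\mathbb P\bigl(S_{n,\alpha,\beta}(i,n+1-i)=\alpha\bigr)=\frac{n-i+b}{n+a+b-1},\qquad 1\le i\le n.$$
   Context: An $\alpha/\beta$-staircase tableau of size $n\ge1$ is a filling of the Young diagram of shape $(n,n-1,\dots,2,1)$, whose boxes are $(i,j)$ (row $i$ from the top, column $j$ from the left) with $i,j\ge1$, $i+j\le n+1$, such that: each box is empty or contains one of the symbols $\alpha,\beta$; no diagonal box (box with $i+j=n+1$) is empty; all boxes in the same row and to the left of a $\beta$ are empty; all boxes in the same column and above an $\alpha$ are empty. Let $\bar{\mathcal S}_n$ be the set of these tableaux. For $S\in\bar{\mathcal S}_n$ let $N_\alpha(S),N_\beta(S)$ be the numbers of symbols $\alpha$ and $\beta$ in $S$, and let $S(i,j)$ be the symbol in box $(i,j)$. For parameter values $\alpha,\beta\in(0,\infty)$, $S_{n,\alpha,\beta}$ is the random element of $\bar{\mathcal S}_n$ with $\mathbb P(S_{n,\alpha,\beta}=S)=\alpha^{N_\alpha(S)}\beta^{N_\beta(S)}/Z_n(\alpha,\beta)$, where $Z_n(\alpha,\beta)=\sum_{S\in\bar{\mathcal S}_n}\alpha^{N_\alpha(S)}\beta^{N_\beta(S)}$. If exactly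 one of $\alpha,\beta$ is $\infty$, the distribution is the limit of this one as that parameter tends to $\infty$ with the other fixed; if $\alpha=\beta=\infty$, it is the limit as $\alpha=\beta\to\infty$. *)

theory Defs
  imports "HOL-Probability.Probability"
begin

datatype symbol = AlphaSym | BetaSym

text \<open>A filling maps a box (row, column), both counted from 1, to its content; \<^const>\<open>None\<close> is the
  empty box. Fillings are \<^const>\<open>None\<close> outside the diagram, so that distinct functions are distinct
  tableaux.\<close>

type_synonym filling = "nat \<Rightarrow> nat \<Rightarrow> symbol option"

definition boxes :: "nat \<Rightarrow> (nat \<times> nat) set" where
  "boxes n = {(i, j). 1 \<le> i \<and> 1 \<le> j \<and> i + j \<le> n + 1}"

definition staircase_tableaux :: "nat \<Rightarrow> filling set" where
  "staircase_tableaux n = {S.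
     (\<forall>i j. (i, j) \<notin> boxes n \<longrightarrow> S i j = None) \<and>
     (\<forall>(i, j)\<in>boxes n. i + j = n + 1 \<longrightarrow> S i j \<noteq> None) \<and>
     (\<forall>(i, j)\<in>boxes n. S i j = Some BetaSym \<longrightarrow> (\<forall>j'. (i, j') \<in> boxes n \<and> j' < j \<longrightarrow> S i j' = None)) \<and>
     (\<forall>(i, j)\<in>boxes n. S i j = Some AlphaSym \<longrightarrow> (\<forall>i'. (i', j) \<in> boxes n \<and> i' < i \<longrightarrow> S i' j = None))}"

definition num_symbol :: "nat \<Rightarrow> symbol \<Rightarrow> filling \<Rightarrow> nat" where
  "num_symbol n s S = card {(i, j). (i, j) \<in> boxes n \<and> S i j = Some s}"

definition weight :: "nat \<Rightarrow> real \<Rightarrow> real \<Rightarrow> filling \<Rightarrow> real" where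
  "weight n \<alpha> \<beta> S = \<alpha> ^ num_symbol n AlphaSym S * \<beta> ^ num_symbol n BetaSym S"

definition partition_sum :: "nat \<Rightarrow> real \<Rightarrow> real \<Rightarrow> real" where
  "partition_sum n \<alpha> \<beta> = (\<Sum>S\<in>staircase_tableaux n. weight n \<alpha> \<beta> S)"

text \<open>Meaningful for positive real parameters; see \<open>pmf_finite_staircase_pmf\<close> below.\<close>

definition finite_staircase_pmf :: "nat \<Rightarrow> real \<Rightarrow> real \<Rightarrow> filling pmf" where
  "finite_staircase_pmf n \<alpha> \<beta> = embed_pmf (\<lambda>S.
     if S \<in> staircase_tableaux n then weight n \<alpha> \<beta> S / partition_sum n \<alpha> \<beta> else 0)"

definition pmf_tendsto_at_top :: "(real \<Rightarrow> 'a pmf) \<Rightarrow> 'a pmf \<Rightarrow> bool" where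
  "pmf_tendsto_at_top P p \<longleftrightarrow> (\<forall>x. ((\<lambda>t. pmf (P t) x) \<longlongrightarrow> pmf p x) at_top)"

definition pmf_limit :: "(real \<Rightarrow> 'a pmf) \<Rightarrow> 'a pmf" where
  "pmf_limit P = (THE p. pmf_tendsto_at_top P p)"

text \<open>The limits below exist; see \<open>staircase_pmf_limits\<close>.\<close>

definition staircase_pmf :: "nat \<Rightarrow> ennreal \<Rightarrow> ennreal \<Rightarrow> filling pmf" where
  "staircase_pmf n \<alpha> \<beta> =
    (if \<alpha> = \<infinity> \<and> \<beta> = \<infinity> then pmf_limit (\<lambda>t. finite_staircase_pmf n t t)
     else if \<alpha> = \<infinity> then pmf_limit (\<lambda>t. finite_staircase_pmf n t (enn2real \<beta>))
     else if \<beta> = \<infinity> then pmf_limit (\<lambda>t. finite_staircase_pmf n (enn2real \<alpha>) t)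
     else finite_staircase_pmf n (enn2real \<alpha>) (enn2real \<beta>))"

lemma finite_boxes: "finite (boxes n)"
  by (rule finite_subset[of _ "{..n+1} \<times> {..n+1}"]) (auto simp: boxes_def)

lemma UNIV_symbol: "(UNIV :: symbol set) = {AlphaSym, BetaSym}"
  using symbol.exhaust by auto

lemma finite_staircase_tableaux: "finite (staircase_tableaux n)"
proof (rule finite_subset)
  let ?F = "{f :: nat \<times> nat \<Rightarrow> symbol option.
     \<forall>x. (x \<in> boxes n \<longrightarrow> f x \<in> UNIV) \<and> (x \<notin> boxes n \<longrightarrow> f x = None)}"
  show "staircase_tableaux n \<subseteq> curry ` ?F"
  proof
    fix S assume "S \<in> staircase_tableaux n"
    then have "case_prod S \<in> ?F" by (auto simp: staircase_tableaux_def)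
    then show "S \<in> curry ` ?F" by (intro image_eqI[where x = "case_prod S"]) simp_all
  qed
  have "finite (UNIV :: symbol set)" by (simp add: UNIV_symbol)
  then have "finite (UNIV :: symbol option set)" by (simp add: UNIV_option_conv)
  then have "finite ?F" by (intro finite_set_of_finite_funs finite_boxes)
  then show "finite (curry ` ?F)" by simp
qed

lemma staircase_tableaux_nonempty: "staircase_tableaux n \<noteq> {}"
proof -
  have "(\<lambda>i j. if (i, j) \<in> boxes n \<and> i + j = n + 1 then Some AlphaSym else None)
      \<in> staircase_tableaux n"
    by (auto simp: staircase_tableaux_def)
  then show ?thesis by blast
qed

lemma partition_sum_pos: "\<alpha> > 0 \<Longrightarrow> \<beta> > 0 \<Longrightarrow> partition_sum n \<alpha> \<beta> > 0"
  unfolding partition_sum_def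
  by (intro sum_pos finite_staircase_tableaux staircase_tableaux_nonempty) (simp add: weight_def)

lemma pmf_embed_finite:
  assumes "finite A" "\<And>x. x \<in> A \<Longrightarrow> f x \<ge> 0" "sum f A = (1::real)"
  shows "pmf (embed_pmf (\<lambda>x. if x \<in> A then f x else 0)) x = (if x \<in> A then f x else 0)"
proof (rule pmf_embed_pmf)
  show "0 \<le> (if x \<in> A then f x else 0)" for x using assms by auto
  have "(\<integral>\<^sup>+x. ennreal (if x \<in> A then f x else 0) \<partial>count_space UNIV)
      = (\<Sum>x\<in>A. ennreal (if x \<in> A then f x else 0))"
    using assms(1) by (intro nn_integral_count_space') auto
  also have "\<dots> = (\<Sum>x\<in>A. ennreal (f x))" by (intro sum.cong) auto
  also have "\<dots> = ennreal (sum f A)" using assms(2) by (intro sum_ennreal) auto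
  finally show "(\<integral>\<^sup>+x. ennreal (if x \<in> A then f x else 0) \<partial>count_space UNIV) = 1"
    using assms(3) by simp
qed

lemma pmf_finite_staircase_pmf:
  assumes "\<alpha> > 0" "\<beta> > 0"
  shows "pmf (finite_staircase_pmf n \<alpha> \<beta>) S =
    (if S \<in> staircase_tableaux n then weight n \<alpha> \<beta> S / partition_sum n \<alpha> \<beta> else 0)"
  unfolding finite_staircase_pmf_def
proof (rule pmf_embed_finite[OF finite_staircase_tableaux])
  have Z: "partition_sum n \<alpha> \<beta> > 0" using partition_sum_pos[OF assms] .
  then show "weight n \<alpha> \<beta> S / partition_sum n \<alpha> \<beta> \<ge> 0" for S
    using assms by (simp add: weight_def)
  have "(\<Sum>S\<in>staircase_tableaux n. weight n \<alpha> \<beta> S / partition_sum n \<alpha> \<beta>)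
     = partition_sum n \<alpha> \<beta> / partition_sum n \<alpha> \<beta>"
    by (simp add: partition_sum_def flip: sum_divide_distrib)
  then show "(\<Sum>S\<in>staircase_tableaux n. weight n \<alpha> \<beta> S / partition_sum n \<alpha> \<beta>) = 1"
    using Z by simp
qed

lemma pmf_limit_eq:
  assumes "pmf_tendsto_at_top P p"
  shows "pmf_limit P = p"
  unfolding pmf_limit_def
proof (rule the_equality)
  show "pmf_tendsto_at_top P p" by (rule assms)
next
  fix q assume "pmf_tendsto_at_top P q"
  then have "pmf q x = pmf p x" for x
    using assms unfolding pmf_tendsto_at_top_def
    by (meson tendsto_unique trivial_limit_at_top_linorder)
  then show "q = p" by (rule pmf_eqI)
qed

lemma monomial_weights_limit:
  fixes c :: "'a \<Rightarrow> real" and k :: "'a \<Rightarrow> nat"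
  assumes A: "finite A" "A \<noteq> {}" and c: "\<And>x. x \<in> A \<Longrightarrow> c x > 0"
    and P: "\<And>t x. t > 0 \<Longrightarrow>
      pmf (P t) x = (if x \<in> A then c x * t ^ k x / (\<Sum>y\<in>A. c y * t ^ k y) else 0)"
  shows "\<exists>p. pmf_tendsto_at_top P p"
proof -
  define K where "K = Max (k ` A)"
  define d where "d x = (if k x = K then c x else 0)" for x
  have kK: "k x \<le> K" if "x \<in> A" for x using that A by (simp add: K_def)
  have "K \<in> k ` A" unfolding K_def using A by (intro Max_in) auto
  then obtain m where m: "m \<in> A" "k m = K" by auto
  have d0: "d x \<ge> 0" if "x \<in> A" for x using c[OF that] by (simp add: d_def)
  have D: "sum d A > 0"
    using m A d0 c by (intro sum_pos2[of A m]) (auto simp: d_def)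
  have lim1: "((\<lambda>t. c x * t ^ k x / t ^ K) \<longlongrightarrow> d x) at_top" if "x \<in> A" for x
  proof (cases "k x = K")
    case True
    have "\<forall>\<^sub>F t in at_top. d x = c x * t ^ k x / t ^ K"
      using eventually_gt_at_top[of 0] by eventually_elim (simp add: d_def True)
    then show ?thesis by (rule Lim_transform_eventually[OF tendsto_const])
  next
    case False
    then have pos: "K - k x > 0" using kK[OF that] by simp
    have "((\<lambda>t::real. c x / t ^ (K - k x)) \<longlongrightarrow> 0) at_top"
      by (intro tendsto_divide_0[OF tendsto_const] filterlim_at_top_imp_at_infinity
          filterlim_pow_at_top pos filterlim_ident)
    moreover have "\<forall>\<^sub>F t::real in at_top. c x / t ^ (K - k x) = c x * t ^ k x / t ^ K"
      using eventually_gt_at_top[of 0]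
    proof eventually_elim
      case (elim t)
      have "t ^ K = t ^ k x * t ^ (K - k x)" using kK[OF that] by (simp flip: power_add)
      then show ?case using elim by simp
    qed
    ultimately show ?thesis using False by (simp add: d_def Lim_transform_eventually)
  qed
  have lim: "((\<lambda>t. c x * t ^ k x / (\<Sum>y\<in>A. c y * t ^ k y)) \<longlongrightarrow> d x / sum d A) at_top"
    if "x \<in> A" for x
  proof (rule Lim_transform_eventually)
    show "((\<lambda>t. (c x * t ^ k x / t ^ K) / (\<Sum>y\<in>A. c y * t ^ k y / t ^ K))
        \<longlongrightarrow> d x / sum d A) at_top"
      using D lim1 that by (intro tendsto_intros) auto
    show "\<forall>\<^sub>F t in at_top. (c x * t ^ k x / t ^ K) / (\<Sum>y\<in>A. c y * t ^ k y / t ^ K)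
        = c x * t ^ k x / (\<Sum>y\<in>A. c y * t ^ k y)"
      using eventually_gt_at_top[of 0]
      by eventually_elim (simp flip: sum_divide_distrib)
  qed
  define p where "p = embed_pmf (\<lambda>x. if x \<in> A then d x / sum d A else 0)"
  have p: "pmf p x = (if x \<in> A then d x / sum d A else 0)" for x
    unfolding p_def using A(1) d0 D
    by (intro pmf_embed_finite) (auto simp flip: sum_divide_distrib)
  have "((\<lambda>t. pmf (P t) x) \<longlongrightarrow> pmf p x) at_top" for x
  proof (rule Lim_transform_eventually)
    show "((\<lambda>t. if x \<in> A then c x * t ^ k x / (\<Sum>y\<in>A. c y * t ^ k y) else 0)
        \<longlongrightarrow> pmf p x) at_top"
      using lim by (auto simp: p)
    show "\<forall>\<^sub>F t in at_top. (if x \<in> A then c x * t ^ k x / (\<Sum>y\<in>A. c y * t ^ k y) else 0)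
        = pmf (P t) x"
      using eventually_gt_at_top[of 0] by eventually_elim (simp add: P)
  qed
  then show ?thesis unfolding pmf_tendsto_at_top_def by blast
qed

lemma staircase_pmf_limits:
  shows "\<exists>p. pmf_tendsto_at_top (\<lambda>t. finite_staircase_pmf n t t) p"
    and "\<beta> > 0 \<Longrightarrow> \<exists>p. pmf_tendsto_at_top (\<lambda>t. finite_staircase_pmf n t \<beta>) p"
    and "\<alpha> > 0 \<Longrightarrow> \<exists>p. pmf_tendsto_at_top (\<lambda>t. finite_staircase_pmf n \<alpha> t) p"
proof -
  note fin = finite_staircase_tableaux[of n] staircase_tableaux_nonempty[of n]
  show "\<exists>p. pmf_tendsto_at_top (\<lambda>t. finite_staircase_pmf n t t) p"
    by (rule monomial_weights_limit[OF fin, where c = "\<lambda>_. 1"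
          and k = "\<lambda>S. num_symbol n AlphaSym S + num_symbol n BetaSym S"])
      (simp_all add: pmf_finite_staircase_pmf partition_sum_def weight_def power_add)
  show "\<exists>p. pmf_tendsto_at_top (\<lambda>t. finite_staircase_pmf n t \<beta>) p" if "\<beta> > 0"
    by (rule monomial_weights_limit[OF fin, where c = "\<lambda>S. \<beta> ^ num_symbol n BetaSym S"
          and k = "num_symbol n AlphaSym"])
      (use that in \<open>simp_all add: pmf_finite_staircase_pmf partition_sum_def weight_def mult.commute\<close>)
  show "\<exists>p. pmf_tendsto_at_top (\<lambda>t. finite_staircase_pmf n \<alpha> t) p" if "\<alpha> > 0"
    by (rule monomial_weights_limit[OF fin, where c = "\<lambda>S. \<alpha> ^ num_symbol n AlphaSym S"
          and k = "num_symbol n BetaSym"])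
      (use that in \<open>simp_all add: pmf_finite_staircase_pmf partition_sum_def weight_def\<close>)
qed

end

theory Submission
  imports Defs
begin

text \<open>A staircase tableau of size \<open>n + 1\<close> is a tableau \<open>S\<close> of size \<open>n\<close> (its columns from the second
  on) together with a first column. The only information about \<open>S\<close> that constrains this column
  is which rows of \<open>S\<close> are free of \<open>\<beta>\<close>: exactly in those rows, and in the new bottom row, the
  column may have a symbol. Hence it pays to refine the weight of a tableau to
  \<open>w x\<^sup>r\<close>, where \<open>w\<close> is its weight and \<open>r\<close> the number of rows free of \<open>\<beta>\<close>. Summing over the first
  column, for \<open>r\<close> free rows, yields \<open>(\<alpha> x + \<beta>) (x + \<beta>)\<^sup>r\<close>. So passing from size
  \<open>n\<close> to size \<open>n + 1\<close> turns a generating function \<open>F(x)\<close> into \<open>(\<alpha> x + \<beta>) F(x + \<beta>)\<close>, and this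
  remains so when the tableaux are restricted by any condition on the columns from the second on
  (\<open>sum_drop_column\<close>).

  The \<open>i\<close>-th diagonal box is the bottom box of the first column once a tableau of size \<open>n\<close> has
  lost its first \<open>n - i\<close> columns. If a bottom box contains \<open>\<alpha>\<close>, the rest of its column is empty,
  so the corresponding generating function in size \<open>i\<close> is \<open>\<alpha> x F\<^sub>i\<^sub>-\<^sub>1(x)\<close>
  (\<open>sum_bottom_alpha\<close>). Applying the above step \<open>n - i\<close> times and comparing with \<open>F\<^sub>n(x)\<close>, which is
  the product of the factors \<open>\<alpha> x + \<beta> + l \<alpha> \<beta>\<close> for \<open>l < n\<close>, all factors but the last one cancel
  (\<open>sum_diagonal_alpha\<close>). For \<open>x = 1\<close> the quotient is
  \<open>\<alpha> (1 + (n - i) \<beta>) / (\<alpha> + \<beta> + (n - 1) \<alpha> \<beta>)\<close>, and division by \<open>\<alpha> \<beta>\<close> gives the formula for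
  finite parameters. Infinite parameters follow by continuity, because the event consists of
  finitely many tableaux.\<close>

section \<open>The generating function of a column\<close>

text \<open>A filled box contributes its symbol; the variable \<open>x\<close> marks the rows that remain free of
  \<open>\<beta>\<close>. An empty box and one with \<open>\<alpha>\<close> keep the row free, so both carry a factor \<open>x\<close>. For
  \<open>x = 1\<close> this is the plain weight of a box.\<close>

definition entry_weight :: "real \<Rightarrow> real \<Rightarrow> real \<Rightarrow> symbol option \<Rightarrow> real" where
  "entry_weight \<alpha> \<beta> x s =
     (case s of None \<Rightarrow> x | Some AlphaSym \<Rightarrow> \<alpha> * x | Some BetaSym \<Rightarrow> \<beta>)"

lemma entry_weight_simps [simp]:
  "entry_weight \<alpha> \<beta> x None = x"
  "entry_weight \<alpha> \<beta> x (Some AlphaSym) = \<alpha> * x"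
  "entry_weight \<alpha> \<beta> x (Some BetaSym) = \<beta>"
  by (simp_all add: entry_weight_def)

text \<open>The fillings of a column in which only the rows of \<open>R\<close> are available, the other rows being
  blocked by a \<open>\<beta>\<close> further to the right.\<close>

definition column_fillings :: "nat set \<Rightarrow> (nat \<Rightarrow> symbol option) set" where
  "column_fillings R = {c. (\<forall>i. i \<notin> R \<longrightarrow> c i = None) \<and>
     (\<forall>i i'. c i = Some AlphaSym \<and> i' < i \<longrightarrow> c i' = None)}"

definition column_weight ::
    "real \<Rightarrow> real \<Rightarrow> real \<Rightarrow> nat set \<Rightarrow> (nat \<Rightarrow> symbol option) \<Rightarrow> real" where
  "column_weight \<alpha> \<beta> x R c = (\<Prod>i\<in>R. entry_weight \<alpha> \<beta> x (c i))"

lemma finite_column_fillings: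
  assumes "finite R"
  shows "finite (column_fillings R)"
proof (rule finite_subset)
  show "column_fillings R \<subseteq> {c. \<forall>i. (i \<in> R \<longrightarrow> c i \<in> UNIV) \<and> (i \<notin> R \<longrightarrow> c i = None)}"
    by (auto simp: column_fillings_def)
  have "finite (UNIV :: symbol set)" by (simp add: UNIV_symbol)
  then have "finite (UNIV :: symbol option set)" by (simp add: UNIV_option_conv)
  then show "finite {c. \<forall>i. (i \<in> R \<longrightarrow> c i \<in> (UNIV :: symbol option set)) \<and> (i \<notin> R \<longrightarrow> c i = None)}"
    by (intro finite_set_of_finite_funs assms)
qed

lemma column_fillings_bottom_empty:
  assumes "m \<notin> R"
  shows "{c \<in> column_fillings (insert m R). c m = None} = column_fillings R"
proof (intro equalityI subsetI)
  fix c assume c: "c \<in> {c \<in> column_fillings (insert m R). c m = None}"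
  have "c i = None" if "i \<notin> R" for i
    using c that by (cases "i = m") (simp_all add: column_fillings_def)
  then show "c \<in> column_fillings R" using c by (simp add: column_fillings_def)
qed (use assms in \<open>simp add: column_fillings_def\<close>)

lemma column_fillings_bottom_alpha:
  assumes "\<And>i. i \<in> R \<Longrightarrow> i < m"
  shows "{c \<in> column_fillings (insert m R). c m = Some AlphaSym} =
    {(\<lambda>_. None)(m := Some AlphaSym)}"
proof (intro equalityI subsetI)
  fix c assume c: "c \<in> {c \<in> column_fillings (insert m R). c m = Some AlphaSym}"
  have "c i = None" if "i \<noteq> m" for i
  proof (cases "i \<in> R")
    case True
    then have "i < m" by (rule assms)
    then show ?thesis using c by (auto simp: column_fillings_def)
  qed (use c that in \<open>simp add: column_fillings_def\<close>)
  with c have "c = (\<lambda>_. None)(m := Some AlphaSym)" by auto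
  then show "c \<in> {(\<lambda>_. None)(m := Some AlphaSym)}" by simp
qed (auto simp: column_fillings_def)

lemma column_fillings_bottom_beta:
  assumes "\<And>i. i \<in> R \<Longrightarrow> i < m"
  shows "{c \<in> column_fillings (insert m R). c m = Some BetaSym} =
    (\<lambda>c. c(m := Some BetaSym)) ` column_fillings R"
proof (intro equalityI subsetI)
  fix c assume c: "c \<in> {c \<in> column_fillings (insert m R). c m = Some BetaSym}"
  then have "c(m := None) \<in> column_fillings R"
    by (auto simp: column_fillings_def)
  moreover from c have "c = (c(m := None))(m := Some BetaSym)" by auto
  ultimately show "c \<in> (\<lambda>c. c(m := Some BetaSym)) ` column_fillings R" by blast
next
  fix c assume "c \<in> (\<lambda>c. c(m := Some BetaSym)) ` column_fillings R"
  then obtain d where d: "d \<in> column_fillings R" "c = d(m := Some BetaSym)" by blast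
  have "\<not> m < i" if "d i = Some AlphaSym" for i
  proof -
    have "i \<in> R" using d(1) that by (force simp: column_fillings_def)
    then show ?thesis using assms by force
  qed
  with d show "c \<in> {c \<in> column_fillings (insert m R). c m = Some BetaSym}"
    by (auto simp: column_fillings_def)
qed

lemma column_weight_insert_upd:
  assumes "finite R" "m \<notin> R"
  shows "column_weight \<alpha> \<beta> x (insert m R) (c(m := s)) =
    entry_weight \<alpha> \<beta> x s * column_weight \<alpha> \<beta> x R c"
proof -
  have "(\<Prod>i\<in>R. entry_weight \<alpha> \<beta> x ((c(m := s)) i)) = (\<Prod>i\<in>R. entry_weight \<alpha> \<beta> x (c i))"
    using assms by (intro prod.cong) auto
  then show ?thesis using assms by (simp add: column_weight_def)
qed

lemma sum_column_bottom_alpha: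
  assumes "finite R" "\<And>i. i \<in> R \<Longrightarrow> i < m"
  shows "(\<Sum>c | c \<in> column_fillings (insert m R) \<and> c m = Some AlphaSym.
      column_weight \<alpha> \<beta> x (insert m R) c) = \<alpha> * x * x ^ card R"
proof -
  have "m \<notin> R" using assms(2) by blast
  then show ?thesis
    using assms(1)
    by (simp add: column_fillings_bottom_alpha[OF assms(2)] column_weight_insert_upd)
      (simp add: column_weight_def)
qed

lemma sum_column_bottom_beta:
  assumes "finite R" "\<And>i. i \<in> R \<Longrightarrow> i < m"
  shows "(\<Sum>c | c \<in> column_fillings (insert m R) \<and> c m = Some BetaSym.
      column_weight \<alpha> \<beta> x (insert m R) c) =
    \<beta> * (\<Sum>c\<in>column_fillings R. column_weight \<alpha> \<beta> x R c)"
proof -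
  have m: "m \<notin> R" using assms(2) by blast
  have "inj_on (\<lambda>c. c(m := Some BetaSym)) (column_fillings R)"
  proof (rule inj_onI)
    fix c d assume "c \<in> column_fillings R" "d \<in> column_fillings R"
      and eq: "c(m := Some BetaSym) = d(m := Some BetaSym)"
    then have "c m = d m" using m by (simp add: column_fillings_def)
    with eq show "c = d" by (metis fun_upd_idem_iff fun_upd_upd)
  qed
  then show ?thesis
    using assms(1) m
    by (simp add: column_fillings_bottom_beta[OF assms(2)] sum.reindex
        column_weight_insert_upd sum_distrib_left)
qed

lemma sum_column_bottom_empty:
  assumes "finite R" "m \<notin> R"
  shows "(\<Sum>c | c \<in> column_fillings (insert m R) \<and> c m = None.
      column_weight \<alpha> \<beta> x (insert m R) c) =
    x * (\<Sum>c\<in>column_fillings R. column_weight \<alpha> \<beta> x R c)"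
proof -
  have "column_weight \<alpha> \<beta> x (insert m R) c = x * column_weight \<alpha> \<beta> x R c"
    if "c \<in> column_fillings R" for c
    using that assms by (simp add: column_weight_def column_fillings_def)
  then show ?thesis
    using assms by (simp add: column_fillings_bottom_empty sum_distrib_left)
qed

lemma sum_split_bottom_entry:
  fixes f :: "(nat \<Rightarrow> symbol option) \<Rightarrow> real"
  assumes "finite A"
  shows "(\<Sum>c | c \<in> A \<and> c m \<noteq> None. f c) =
      (\<Sum>c | c \<in> A \<and> c m = Some AlphaSym. f c) + (\<Sum>c | c \<in> A \<and> c m = Some BetaSym. f c)"
    and "(\<Sum>c\<in>A. f c) =
      (\<Sum>c | c \<in> A \<and> c m = None. f c) + (\<Sum>c | c \<in> A \<and> c m \<noteq> None. f c)"
proof -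
  have cases: "s \<noteq> None \<longleftrightarrow> s = Some AlphaSym \<or> s = Some BetaSym" for s
    by (metis option.distinct(1) option.exhaust symbol.exhaust)
  have eq: "{c \<in> A. c m \<noteq> None} =
      {c \<in> A. c m = Some AlphaSym} \<union> {c \<in> A. c m = Some BetaSym}"
    unfolding cases by blast
  show "(\<Sum>c | c \<in> A \<and> c m \<noteq> None. f c) =
      (\<Sum>c | c \<in> A \<and> c m = Some AlphaSym. f c) + (\<Sum>c | c \<in> A \<and> c m = Some BetaSym. f c)"
    unfolding eq using assms by (intro sum.union_disjoint) auto
  have "A = {c \<in> A. c m = None} \<union> {c \<in> A. c m \<noteq> None}" by auto
  then have "sum f A = sum f ({c \<in> A. c m = None} \<union> {c \<in> A. c m \<noteq> None})" by simp
  also have "\<dots> = sum f {c \<in> A. c m = None} + sum f {c \<in> A. c m \<noteq> None}"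
    using assms by (intro sum.union_disjoint) auto
  finally show "(\<Sum>c\<in>A. f c) =
      (\<Sum>c | c \<in> A \<and> c m = None. f c) + (\<Sum>c | c \<in> A \<and> c m \<noteq> None. f c)" .
qed

text \<open>Stated with the sum multiplied by \<open>\<beta>\<close>, since solving for the sum would need division by
  \<open>\<beta>\<close>. Both sides of this form are multiplied by \<open>x + \<beta>\<close> when a new bottom row is made available:
  an empty or \<open>\<beta>\<close> box there leaves the rest of the column arbitrary, an \<open>\<alpha>\<close> empties it.\<close>

lemma sum_column_fillings:
  assumes "finite R"
  shows "\<beta> * (\<Sum>c\<in>column_fillings R. column_weight \<alpha> \<beta> x R c) + \<alpha> * x * x ^ card R =
    (\<alpha> * x + \<beta>) * (x + \<beta>) ^ card R"
  using assms
proof (induction R rule: finite_linorder_max_induct)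
  case empty
  have "column_fillings {} = {\<lambda>_. None}" by (auto simp: column_fillings_def)
  then show ?case by (simp add: column_weight_def)
next
  case (insert m R)
  let ?G = "\<Sum>c\<in>column_fillings R. column_weight \<alpha> \<beta> x R c"
  have m: "m \<notin> R" using insert.hyps by blast
  have "(\<Sum>c\<in>column_fillings (insert m R). column_weight \<alpha> \<beta> x (insert m R) c) =
      x * ?G + (\<alpha> * x * x ^ card R + \<beta> * ?G)"
    using insert.hyps m finite_column_fillings[of "insert m R"]
    by (subst sum_split_bottom_entry(2)[where m = m])
      (simp_all only: sum_split_bottom_entry(1) finite_insert simp_thms
        sum_column_bottom_empty sum_column_bottom_alpha sum_column_bottom_beta)
  then have "\<beta> * (\<Sum>c\<in>column_fillings (insert m R). column_weight \<alpha> \<beta> x (insert m R) c)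
      + \<alpha> * x * x ^ card (insert m R) = (x + \<beta>) * (\<beta> * ?G + \<alpha> * x * x ^ card R)"
    using m insert.hyps by (simp add: algebra_simps)
  also have "\<dots> = (\<alpha> * x + \<beta>) * (x + \<beta>) ^ card (insert m R)"
    using m insert.hyps unfolding insert.IH by simp
  finally show ?case .
qed

text \<open>The bottom box of a column of a tableau lies on the diagonal and must be filled. The two
  possible symbols account for the two summands in the preceding identity.\<close>

lemma sum_column_bottom_nonempty:
  assumes "finite R" "\<And>i. i \<in> R \<Longrightarrow> i < m"
  shows "(\<Sum>c | c \<in> column_fillings (insert m R) \<and> c m \<noteq> None.
      column_weight \<alpha> \<beta> x (insert m R) c) = (\<alpha> * x + \<beta>) * (x + \<beta>) ^ card R"
proof -
  have "finite (column_fillings (insert m R))"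
    using assms(1) by (simp add: finite_column_fillings)
  then show ?thesis
    unfolding sum_column_fillings[OF assms(1), symmetric]
    by (simp only: sum_split_bottom_entry(1) sum_column_bottom_alpha[OF assms]
        sum_column_bottom_beta[OF assms] add.commute)
qed

section \<open>Removing the first column of a tableau\<close>

definition free_rows :: "nat \<Rightarrow> filling \<Rightarrow> nat set" where
  "free_rows n S = {i \<in> {1..n}. \<forall>j. S i j \<noteq> Some BetaSym}"

lemma free_rows_finite [simp]: "finite (free_rows n S)"
  by (simp add: free_rows_def)

definition refined_weight :: "nat \<Rightarrow> real \<Rightarrow> real \<Rightarrow> real \<Rightarrow> filling \<Rightarrow> real" where
  "refined_weight n \<alpha> \<beta> x S = weight n \<alpha> \<beta> S * x ^ card (free_rows n S)"

definition drop_column :: "filling \<Rightarrow> filling" where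
  "drop_column S = (\<lambda>i j. if j = 0 then None else S i (Suc j))"

definition add_column :: "(nat \<Rightarrow> symbol option) \<Rightarrow> filling \<Rightarrow> filling" where
  "add_column c S = (\<lambda>i j. if j = 0 then None else if j = 1 then c i else S i (j - 1))"

lemma weight_eq_prod:
  "weight n \<alpha> \<beta> S = (\<Prod>(i, j)\<in>boxes n. entry_weight \<alpha> \<beta> 1 (S i j))"
proof -
  have ew: "entry_weight \<alpha> \<beta> 1 s =
      (if s = Some AlphaSym then \<alpha> else 1) * (if s = Some BetaSym then \<beta> else 1)" for s
  proof (cases s)
    case (Some y)
    then show ?thesis by (cases y) simp_all
  qed simp
  have "(\<Prod>(i, j)\<in>boxes n. if S i j = Some s then y else 1) = y ^ num_symbol n s S" for s and y :: real
  proof -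
    have "(\<Prod>(i, j)\<in>boxes n. if S i j = Some s then y else 1) =
        (\<Prod>p\<in>{p \<in> boxes n. S (fst p) (snd p) = Some s}. y)"
      unfolding case_prod_unfold by (rule prod.inter_filter[OF finite_boxes, symmetric])
    also have "{p \<in> boxes n. S (fst p) (snd p) = Some s} =
        {(i, j). (i, j) \<in> boxes n \<and> S i j = Some s}" by auto
    finally show ?thesis by (simp add: num_symbol_def)
  qed
  from this[of AlphaSym \<alpha>] this[of BetaSym \<beta>] show ?thesis
    by (simp add: ew weight_def case_prod_unfold prod.distrib)
qed

text \<open>Because a tableau is empty outside the diagram, the two emptiness conditions can be stated
  for arbitrary indices, which removes most side conditions when columns are shifted.\<close>

lemma staircase_tableaux_iff:
  "S \<in> staircase_tableaux n \<longleftrightarrow>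
     (\<forall>i j. (i, j) \<notin> boxes n \<longrightarrow> S i j = None) \<and>
     (\<forall>i j. (i, j) \<in> boxes n \<and> i + j = n + 1 \<longrightarrow> S i j \<noteq> None) \<and>
     (\<forall>i j j'. S i j = Some BetaSym \<and> j' < j \<longrightarrow> S i j' = None) \<and>
     (\<forall>i j i'. S i j = Some AlphaSym \<and> i' < i \<longrightarrow> S i' j = None)"
  (is "_ = (?out \<and> ?diag \<and> ?beta \<and> ?alpha)")
proof
  assume S: "S \<in> staircase_tableaux n"
  then have out: ?out and ?diag by (auto simp: staircase_tableaux_def)
  moreover have ?beta
  proof (intro allI impI, elim conjE)
    fix i j j' assume *: "S i j = Some BetaSym" "j' < j"
    then have "(i, j) \<in> boxes n" using out by force
    then show "S i j' = None"
      using S * out by (cases "(i, j') \<in> boxes n") (fastforce simp: staircase_tableaux_def)+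
  qed
  moreover have ?alpha
  proof (intro allI impI, elim conjE)
    fix i j i' assume *: "S i j = Some AlphaSym" "i' < i"
    then have "(i, j) \<in> boxes n" using out by force
    then show "S i' j = None"
      using S * out by (cases "(i', j) \<in> boxes n") (fastforce simp: staircase_tableaux_def)+
  qed
  ultimately show "?out \<and> ?diag \<and> ?beta \<and> ?alpha" by blast
next
  assume "?out \<and> ?diag \<and> ?beta \<and> ?alpha"
  then show "S \<in> staircase_tableaux n" unfolding staircase_tableaux_def by blast
qed

lemma
  assumes "S \<in> staircase_tableaux n"
  shows tableau_outside: "(i, j) \<notin> boxes n \<Longrightarrow> S i j = None"
    and tableau_diagonal: "(i, j) \<in> boxes n \<Longrightarrow> i + j = n + 1 \<Longrightarrow> S i j \<noteq> None"
    and tableau_beta: "S i j = Some BetaSym \<Longrightarrow> j' < j \<Longrightarrow> S i j' = None"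
    and tableau_alpha: "S i j = Some AlphaSym \<Longrightarrow> i' < i \<Longrightarrow> S i' j = None"
  using assms unfolding staircase_tableaux_iff by blast+

lemma boxes_Suc: "(i, Suc j) \<in> boxes (Suc n) \<longleftrightarrow>
    (if j = 0 then i \<in> {1..Suc n} else (i, j) \<in> boxes n)"
  by (auto simp: boxes_def)

text \<open>The conditions on a tableau split into those on the shifted tableau and those on the first
  column: the \<open>\<alpha>\<close>-condition concerns each column separately, and the \<open>\<beta>\<close>-condition between the
  first column and the others says precisely that the first column is empty in the rows that are
  not free.\<close>

lemma tableau_drop_column_iff:
  "S \<in> staircase_tableaux (Suc n) \<longleftrightarrow>
    drop_column S \<in> staircase_tableaux n \<and> (\<forall>i. S i 0 = None) \<and>
    (\<lambda>i. S i 1) \<in> column_fillings (insert (Suc n) (free_rows n (drop_column S))) \<and>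
    S (Suc n) 1 \<noteq> None"
  (is "?L \<longleftrightarrow> ?R")
proof
  assume S: ?L
  note out = tableau_outside[OF S] and diag = tableau_diagonal[OF S]
    and beta = tableau_beta[OF S] and alpha = tableau_alpha[OF S]
  have "drop_column S \<in> staircase_tableaux n"
    unfolding staircase_tableaux_iff drop_column_def
  proof (intro conjI allI impI, goal_cases)
    case (1 i j)
    then show ?case using out[of i "Suc j"] by (auto simp: boxes_Suc)
  next
    case (2 i j)
    then have "j \<noteq> 0" by (simp add: boxes_def)
    with 2 show ?case using diag[of i "Suc j"] by (simp add: boxes_Suc)
  next
    case (3 i j j')
    then show ?case using beta[of i "Suc j" "Suc j'"] by (auto split: if_splits)
  next
    case (4 i j i')
    then show ?case using alpha[of i "Suc j" i'] by (auto split: if_splits)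
  qed
  moreover have "S i 0 = None" for i
    by (rule out) (simp add: boxes_def)
  moreover have "(\<lambda>i. S i 1) \<in> column_fillings (insert (Suc n) (free_rows n (drop_column S)))"
    unfolding column_fillings_def
  proof (intro CollectI conjI allI impI)
    fix i assume i: "i \<notin> insert (Suc n) (free_rows n (drop_column S))"
    show "S i 1 = None"
    proof (cases "i \<in> {1..n}")
      case True
      with i obtain j where "drop_column S i j = Some BetaSym" by (auto simp: free_rows_def)
      then have "S i (Suc j) = Some BetaSym" "1 < Suc j"
        by (auto simp: drop_column_def split: if_splits)
      then show ?thesis by (rule beta)
    next
      case False
      with i show ?thesis by (intro out) (auto simp: boxes_def)
    qed
  next
    fix i i' assume "S i 1 = Some AlphaSym \<and> i' < i"
    then show "S i' 1 = None" using alpha by blast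
  qed
  moreover have "S (Suc n) 1 \<noteq> None"
    by (rule diag) (auto simp: boxes_def)
  ultimately show ?R by blast
next
  assume R: ?R
  then have zero: "S i 0 = None" for i by blast
  from R have Sdrop: "drop_column S \<in> staircase_tableaux n" by blast
  have out: "S i (Suc (Suc j)) = None" if "(i, Suc j) \<notin> boxes n" for i j
    using tableau_outside[OF Sdrop that] by (simp add: drop_column_def)
  have diag: "S i (Suc (Suc j)) \<noteq> None" if "(i, Suc j) \<in> boxes n" "i + j = n" for i j
    using tableau_diagonal[OF Sdrop that(1)] that(2) by (simp add: drop_column_def)
  have beta: "S i (Suc (Suc j')) = None" if "S i (Suc (Suc j)) = Some BetaSym" "j' < j" for i j j'
    using tableau_beta[OF Sdrop, of i "Suc j" "Suc j'"] that by (simp add: drop_column_def)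
  have alpha: "S i' (Suc (Suc j)) = None" if "S i (Suc (Suc j)) = Some AlphaSym" "i' < i" for i j i'
    using tableau_alpha[OF Sdrop, of i "Suc j" i'] that by (simp add: drop_column_def)
  have col: "S i 1 = None" if "i \<notin> insert (Suc n) (free_rows n (drop_column S))" for i
    using R that by (simp add: column_fillings_def)
  have col_alpha: "S i' 1 = None" if "S i 1 = Some AlphaSym" "i' < i" for i i'
    using R that unfolding column_fillings_def by blast
  show ?L
    unfolding staircase_tableaux_iff
  proof (intro conjI allI impI, goal_cases)
    case (1 i j)
    consider "j = 0" | "j = 1" | k where "j = Suc (Suc k)"
      by (metis One_nat_def not0_implies_Suc)
    then show ?case
    proof cases
      case 2
      with 1 have "i \<notin> {1..Suc n}" by (auto simp: boxes_def)
      then show ?thesis unfolding 2 by (intro col) (auto simp: free_rows_def)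
    qed (use 1 zero out in \<open>auto simp: boxes_Suc\<close>)
  next
    case (2 i j)
    then consider "j = 1" "i = Suc n" | k where "j = Suc (Suc k)"
      by (cases j rule: nat.exhaust; cases "j - 1") (auto simp: boxes_def)
    then show ?case
      by cases (use 2 R diag in \<open>auto simp: boxes_Suc\<close>)
  next
    case prems: (3 i j j')
    then obtain k where k: "j = Suc k" by (cases j) auto
    (* Only j' = 1 involves both parts: a beta further right makes row i unavailable. *)
    consider "j' = 0" | "j' = 1" | k' where "j' = Suc (Suc k')"
      by (metis One_nat_def not0_implies_Suc)
    then show ?case
    proof cases
      case 2
      then obtain l where l: "j = Suc (Suc l)" using prems k by (cases k) auto
      then have "drop_column S i (Suc l) = Some BetaSym" using prems by (simp add: drop_column_def)
      then have "(i, Suc l) \<in> boxes n" "i \<notin> free_rows n (drop_column S)"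
        using out[of i l] by (auto simp: free_rows_def drop_column_def)
      then show ?thesis unfolding 2 by (intro col) (auto simp: boxes_def)
    next
      case 3
      then obtain l where l: "j = Suc (Suc l)" using prems k by (cases k) auto
      then show ?thesis using prems 3 beta by auto
    qed (use zero in simp)
  next
    case (4 i j i')
    consider "j = 0" | "j = 1" | k where "j = Suc (Suc k)"
      by (metis One_nat_def not0_implies_Suc)
    then show ?case
      by cases (use 4 zero col_alpha alpha in auto)
  qed
qed

lemma weight_add_column:
  "weight (Suc n) \<alpha> \<beta> (add_column c S) =
    (\<Prod>i=1..Suc n. entry_weight \<alpha> \<beta> 1 (c i)) * weight n \<alpha> \<beta> S"
proof -
  let ?w = "\<lambda>(i, j). entry_weight \<alpha> \<beta> 1 (add_column c S i j)"
  let ?left = "(\<lambda>i. (i, 1::nat)) ` {1..Suc n}" and ?right = "(\<lambda>(i, j). (i, Suc j)) ` boxes n"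
  have eq: "boxes (Suc n) = ?left \<union> ?right"
  proof (intro set_eqI iffI)
    fix p assume "p \<in> boxes (Suc n)"
    moreover obtain i j where "p = (i, j)" by fastforce
    moreover from calculation obtain k where "j = Suc k" by (cases j) (auto simp: boxes_def)
    ultimately show "p \<in> ?left \<union> ?right" by (force simp: boxes_Suc split: if_splits)
  qed (auto simp: boxes_def)
  have "?left \<inter> ?right = {}" by (auto simp: boxes_def)
  then have "prod ?w (boxes (Suc n)) = prod ?w ?left * prod ?w ?right"
    unfolding eq by (intro prod.union_disjoint finite_imageI finite_boxes finite_atLeastAtMost)
  also have "prod ?w ?left = (\<Prod>i=1..Suc n. entry_weight \<alpha> \<beta> 1 (c i))"
    by (subst prod.reindex) (auto simp: inj_on_def add_column_def)
  also have "prod ?w ?right = (\<Prod>(i, j)\<in>boxes n. entry_weight \<alpha> \<beta> 1 (S i j))"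
    by (subst prod.reindex) (auto simp: inj_on_def add_column_def boxes_def intro!: prod.cong)
  finally show ?thesis by (simp add: weight_eq_prod)
qed

text \<open>A row of the new tableau is free if it was free before (or is the new bottom row) and does
  not get a \<open>\<beta>\<close> in the first column, so the power of \<open>x\<close> depends only on the column and can be
  distributed over its available boxes.\<close>

lemma refined_weight_add_column:
  assumes S: "S \<in> staircase_tableaux n"
    and c: "c \<in> column_fillings (insert (Suc n) (free_rows n S))"
  shows "refined_weight (Suc n) \<alpha> \<beta> x (add_column c S) =
    weight n \<alpha> \<beta> S * column_weight \<alpha> \<beta> x (insert (Suc n) (free_rows n S)) c"
proof -
  let ?R = "insert (Suc n) (free_rows n S)"
  have out: "S i j = None" if "(i, j) \<notin> boxes n" for i j
    using S that by (simp add: staircase_tableaux_iff)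
  have "free_rows (Suc n) (add_column c S) = {i \<in> ?R. c i \<noteq> Some BetaSym}"
  proof (intro set_eqI iffI)
    fix i assume i: "i \<in> free_rows (Suc n) (add_column c S)"
    then have free: "add_column c S i j \<noteq> Some BetaSym" for j by (simp add: free_rows_def)
    have "S i j \<noteq> Some BetaSym" for j
      using free[of "Suc j"] out[of i j] by (cases "j = 0") (auto simp: add_column_def boxes_def)
    moreover have "c i \<noteq> Some BetaSym" using free[of 1] by (simp add: add_column_def)
    ultimately show "i \<in> {i \<in> ?R. c i \<noteq> Some BetaSym}" using i by (auto simp: free_rows_def)
  next
    fix i assume i: "i \<in> {i \<in> ?R. c i \<noteq> Some BetaSym}"
    then have "S i j \<noteq> Some BetaSym" for j
      using out[of i j] by (auto simp: free_rows_def boxes_def)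
    with i show "i \<in> free_rows (Suc n) (add_column c S)"
      by (auto simp: free_rows_def add_column_def)
  qed
  then have rows: "x ^ card (free_rows (Suc n) (add_column c S)) =
      (\<Prod>i\<in>?R. if c i \<noteq> Some BetaSym then x else 1)"
    by (simp add: prod.inter_filter[symmetric] del: prod.insert)
  have "(\<Prod>i=1..Suc n. entry_weight \<alpha> \<beta> 1 (c i)) = (\<Prod>i\<in>?R. entry_weight \<alpha> \<beta> 1 (c i))"
    using c by (intro prod.mono_neutral_right) (auto simp: free_rows_def column_fillings_def)
  then have "refined_weight (Suc n) \<alpha> \<beta> x (add_column c S) = weight n \<alpha> \<beta> S *
      (\<Prod>i\<in>?R. entry_weight \<alpha> \<beta> 1 (c i) * (if c i \<noteq> Some BetaSym then x else 1))"
    unfolding refined_weight_def rows weight_add_column prod.distrib by (simp only: mult_ac)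
  also have "(\<Prod>i\<in>?R. entry_weight \<alpha> \<beta> 1 (c i) * (if c i \<noteq> Some BetaSym then x else 1)) =
      column_weight \<alpha> \<beta> x ?R c"
    unfolding column_weight_def
    by (intro prod.cong) (auto simp: entry_weight_def split: option.splits symbol.splits)
  finally show ?thesis .
qed

text \<open>The predicate \<open>P\<close> on the bottom box serves to treat the full sum and the sum over columns
  with bottom \<open>\<alpha>\<close> at once.\<close>

lemma sum_tableaux_by_first_column:
  assumes A: "A \<subseteq> staircase_tableaux n"
  shows "(\<Sum>S | S \<in> staircase_tableaux (Suc n) \<and> drop_column S \<in> A \<and> P (S (Suc n) 1).
      refined_weight (Suc n) \<alpha> \<beta> x S) =
    (\<Sum>S\<in>A. weight n \<alpha> \<beta> S *
      (\<Sum>c | c \<in> column_fillings (insert (Suc n) (free_rows n S)) \<and> c (Suc n) \<noteq> None \<and> P (c (Suc n)).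
        column_weight \<alpha> \<beta> x (insert (Suc n) (free_rows n S)) c))"
proof -
  let ?R = "\<lambda>S. insert (Suc n) (free_rows n S)"
  let ?C = "\<lambda>S. {c. c \<in> column_fillings (?R S) \<and> c (Suc n) \<noteq> None \<and> P (c (Suc n))}"
  have fin: "finite A" using A finite_staircase_tableaux by (rule finite_subset)
  have "(\<Sum>S\<in>A. weight n \<alpha> \<beta> S * (\<Sum>c\<in>?C S. column_weight \<alpha> \<beta> x (?R S) c)) =
      (\<Sum>(S, c)\<in>Sigma A ?C. weight n \<alpha> \<beta> S * column_weight \<alpha> \<beta> x (?R S) c)"
    using fin by (simp add: sum_distrib_left sum.Sigma finite_column_fillings)
  also have "\<dots> = (\<Sum>S | S \<in> staircase_tableaux (Suc n) \<and> drop_column S \<in> A \<and> P (S (Suc n) 1).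
      refined_weight (Suc n) \<alpha> \<beta> x S)"
  proof (rule sum.reindex_bij_witness[where i = "\<lambda>S. (drop_column S, \<lambda>i. S i 1)"
        and j = "\<lambda>(S, c). add_column c S"], goal_cases)
    case (1 p)
    then obtain S c where p: "p = (S, c)" "S \<in> A" "c \<in> ?C S" by auto
    then have "S i 0 = None" for i
      using A by (auto simp: staircase_tableaux_def boxes_def)
    with p show ?case by (auto simp: drop_column_def add_column_def fun_eq_iff)
  next
    case (2 p)
    then obtain S c where p: "p = (S, c)" "S \<in> A" "c \<in> ?C S" by auto
    then have "S i 0 = None" for i
      using A by (auto simp: staircase_tableaux_def boxes_def)
    then have d: "drop_column (add_column c S) = S"
      by (auto simp: drop_column_def add_column_def fun_eq_iff)
    show ?case using p A d
      by (auto simp: tableau_drop_column_iff[of _ n]) (auto simp: add_column_def)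
  next
    case (3 S)
    then show ?case
      by (auto simp: tableau_drop_column_iff[of S n] add_column_def drop_column_def fun_eq_iff)
  next
    case (4 S)
    then show ?case by (auto simp: tableau_drop_column_iff[of S n])
  next
    case (5 p)
    then show ?case using A by (auto simp: refined_weight_add_column)
  qed
  finally show ?thesis by simp
qed

text \<open>The factor \<open>(x + \<beta>)\<^sup>r\<close> from summing over the column is again a refined weight, with
  \<open>x + \<beta>\<close> in place of \<open>x\<close>; this is what makes the recursion close.\<close>

lemma sum_drop_column:
  assumes "A \<subseteq> staircase_tableaux n"
  shows "(\<Sum>S | S \<in> staircase_tableaux (Suc n) \<and> drop_column S \<in> A. refined_weight (Suc n) \<alpha> \<beta> x S) =
    (\<alpha> * x + \<beta>) * (\<Sum>S\<in>A. refined_weight n \<alpha> \<beta> (x + \<beta>) S)"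
proof -
  have "(\<Sum>c | c \<in> column_fillings (insert (Suc n) (free_rows n S)) \<and> c (Suc n) \<noteq> None.
      column_weight \<alpha> \<beta> x (insert (Suc n) (free_rows n S)) c) =
      (\<alpha> * x + \<beta>) * (x + \<beta>) ^ card (free_rows n S)" for S
    by (rule sum_column_bottom_nonempty) (auto simp: free_rows_def)
  then show ?thesis
    using sum_tableaux_by_first_column[OF assms, of \<alpha> \<beta> x "\<lambda>_. True"]
    by (simp add: refined_weight_def sum_distrib_left mult_ac)
qed

lemma sum_bottom_alpha:
  "(\<Sum>S | S \<in> staircase_tableaux (Suc n) \<and> S (Suc n) 1 = Some AlphaSym.
      refined_weight (Suc n) \<alpha> \<beta> x S) =
    \<alpha> * x * (\<Sum>S\<in>staircase_tableaux n. refined_weight n \<alpha> \<beta> x S)"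
proof -
  have "(\<Sum>c | c \<in> column_fillings (insert (Suc n) (free_rows n S)) \<and> c (Suc n) \<noteq> None \<and>
        c (Suc n) = Some AlphaSym.
      column_weight \<alpha> \<beta> x (insert (Suc n) (free_rows n S)) c) =
      \<alpha> * x * x ^ card (free_rows n S)" for S
  proof -
    have "{c. c \<in> column_fillings (insert (Suc n) (free_rows n S)) \<and> c (Suc n) \<noteq> None \<and>
        c (Suc n) = Some AlphaSym} =
        {c. c \<in> column_fillings (insert (Suc n) (free_rows n S)) \<and> c (Suc n) = Some AlphaSym}"
      by auto
    then show ?thesis
      using sum_column_bottom_alpha[of "free_rows n S" "Suc n" \<alpha> \<beta> x] by (simp add: free_rows_def)
  qed
  moreover have "{S. S \<in> staircase_tableaux (Suc n) \<and> drop_column S \<in> staircase_tableaux n \<and>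
      S (Suc n) 1 = Some AlphaSym} =
      {S. S \<in> staircase_tableaux (Suc n) \<and> S (Suc n) 1 = Some AlphaSym}"
    using tableau_drop_column_iff by auto
  ultimately show ?thesis
    using sum_tableaux_by_first_column[of "staircase_tableaux n" n \<alpha> \<beta> x
        "\<lambda>s. s = Some AlphaSym"]
    by (simp add: refined_weight_def sum_distrib_left mult_ac)
qed

section \<open>The symbol in a diagonal box\<close>

definition refined_partition_sum :: "nat \<Rightarrow> real \<Rightarrow> real \<Rightarrow> real \<Rightarrow> real" where
  "refined_partition_sum n \<alpha> \<beta> x = (\<Sum>S\<in>staircase_tableaux n. refined_weight n \<alpha> \<beta> x S)"

lemma refined_partition_sum_Suc_shift:
  "refined_partition_sum (Suc n) \<alpha> \<beta> x = (\<alpha> * x + \<beta>) * refined_partition_sum n \<alpha> \<beta> (x + \<beta>)"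
proof -
  have "{S. S \<in> staircase_tableaux (Suc n) \<and> drop_column S \<in> staircase_tableaux n} =
      staircase_tableaux (Suc n)"
    using tableau_drop_column_iff by auto
  then show ?thesis
    using sum_drop_column[of "staircase_tableaux n" n \<alpha> \<beta> x] by (simp add: refined_partition_sum_def)
qed

text \<open>The first-column recursion shifts the argument; iterating it shows that the generating
  function is a product, whose last factor is split off here.\<close>

lemma refined_partition_sum_Suc_same_argument:
  "refined_partition_sum (Suc n) \<alpha> \<beta> x =
    (\<alpha> * x + \<beta> + real n * \<alpha> * \<beta>) * refined_partition_sum n \<alpha> \<beta> x"
proof (induction n arbitrary: x)
  case 0
  have "refined_partition_sum 0 \<alpha> \<beta> y = refined_partition_sum 0 \<alpha> \<beta> z" for y z
    by (simp add: refined_partition_sum_def refined_weight_def free_rows_def)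
  then show ?case by (simp add: refined_partition_sum_Suc_shift[of 0]) 
next
  case (Suc n)
  have "refined_partition_sum (Suc (Suc n)) \<alpha> \<beta> x =
      (\<alpha> * x + \<beta>) * ((\<alpha> * (x + \<beta>) + \<beta> + real n * \<alpha> * \<beta>) * refined_partition_sum n \<alpha> \<beta> (x + \<beta>))"
    by (simp only: refined_partition_sum_Suc_shift[of "Suc n"] Suc.IH)
  also have "\<dots> = (\<alpha> * x + \<beta> + real (Suc n) * \<alpha> * \<beta>) *
      ((\<alpha> * x + \<beta>) * refined_partition_sum n \<alpha> \<beta> (x + \<beta>))"
    by (simp add: algebra_simps)
  finally show ?case by (simp only: refined_partition_sum_Suc_shift[of n])
qed

definition diagonal_alpha :: "nat \<Rightarrow> nat \<Rightarrow> filling set" where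
  "diagonal_alpha n i = {S \<in> staircase_tableaux n. S i (n + 1 - i) = Some AlphaSym}"

text \<open>Induction on \<open>n\<close> starting at \<open>i\<close>, where the box is the bottom of the first column. In each
  further step both sides pass from \<open>x\<close> to \<open>x + \<beta>\<close> with the same factor \<open>\<alpha> x + \<beta>\<close>, and the
  explicit coefficients are invariant because \<open>\<alpha> (x + \<beta>) + (n - 1) \<alpha> \<beta> = \<alpha> x + n \<alpha> \<beta>\<close> and
  \<open>(x + \<beta>) + (n - i) \<beta> = x + (n + 1 - i) \<beta>\<close>.\<close>

lemma sum_diagonal_alpha:
  assumes "1 \<le> i" "i \<le> n"
  shows "(\<alpha> * x + \<beta> + (real n - 1) * \<alpha> * \<beta>) * (\<Sum>S\<in>diagonal_alpha n i. refined_weight n \<alpha> \<beta> x S) =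
    \<alpha> * (x + (real n - real i) * \<beta>) * refined_partition_sum n \<alpha> \<beta> x"
  using assms(2)
proof (induction n arbitrary: x rule: dec_induct)
  case base
  obtain m where i: "i = Suc m" using assms(1) by (cases i) auto
  have "(\<Sum>S\<in>diagonal_alpha i i. refined_weight i \<alpha> \<beta> x S) =
      \<alpha> * x * refined_partition_sum m \<alpha> \<beta> x"
    using sum_bottom_alpha[of m \<alpha> \<beta> x] by (simp add: i diagonal_alpha_def refined_partition_sum_def)
  then show ?case by (simp add: i refined_partition_sum_Suc_same_argument mult_ac)
next
  case (step n)
  let ?H = "\<Sum>S\<in>diagonal_alpha n i. refined_weight n \<alpha> \<beta> (x + \<beta>) S"
  have "{S. S \<in> staircase_tableaux (Suc n) \<and> drop_column S \<in> diagonal_alpha n i} =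
      diagonal_alpha (Suc n) i"
    using step.hyps tableau_drop_column_iff[of _ n]
    by (auto simp: diagonal_alpha_def drop_column_def Suc_diff_le)
  then have H: "(\<Sum>S\<in>diagonal_alpha (Suc n) i. refined_weight (Suc n) \<alpha> \<beta> x S) =
      (\<alpha> * x + \<beta>) * ?H"
    using sum_drop_column[of "diagonal_alpha n i" n \<alpha> \<beta> x] by (simp add: diagonal_alpha_def)
  have "(\<alpha> * x + \<beta> + (real (Suc n) - 1) * \<alpha> * \<beta>) * ((\<alpha> * x + \<beta>) * ?H) =
      (\<alpha> * x + \<beta>) * ((\<alpha> * (x + \<beta>) + \<beta> + (real n - 1) * \<alpha> * \<beta>) * ?H)"
    by (simp add: algebra_simps)
  also have "\<dots> = \<alpha> * (x + (real (Suc n) - real i) * \<beta>) *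
      ((\<alpha> * x + \<beta>) * refined_partition_sum n \<alpha> \<beta> (x + \<beta>))"
    unfolding step.IH by (simp add: algebra_simps)
  finally show ?case by (simp only: H refined_partition_sum_Suc_shift[of n])
qed

section \<open>Probabilities for finite and infinite parameters\<close>

text \<open>Reduces the event, an infinite set of fillings, to a finite sum of point masses, through
  which pointwise limits can be taken.\<close>

lemma prob_on_tableaux:
  assumes "\<And>S. S \<notin> staircase_tableaux n \<Longrightarrow> pmf p S = 0"
  shows "measure_pmf.prob p {S. S i (n + 1 - i) = Some AlphaSym} = (\<Sum>S\<in>diagonal_alpha n i. pmf p S)"
proof -
  have "measure_pmf.prob p {S. S i (n + 1 - i) = Some AlphaSym} = measure_pmf.prob p (diagonal_alpha n i)"
    using assms
    by (intro measure_eq_AE AE_pmfI) (auto simp: diagonal_alpha_def set_pmf_iff)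
  then show ?thesis
    using finite_staircase_tableaux by (simp add: measure_measure_pmf_finite diagonal_alpha_def)
qed

lemma prob_diagonal_alpha_finite:
  assumes "\<alpha> > 0" "\<beta> > 0" "1 \<le> i" "i \<le> n"
  shows "(\<Sum>S\<in>diagonal_alpha n i. pmf (finite_staircase_pmf n \<alpha> \<beta>) S) =
    (real n - real i + inverse \<beta>) / (real n + inverse \<alpha> + inverse \<beta> - 1)"
proof -
  let ?W = "\<Sum>S\<in>diagonal_alpha n i. weight n \<alpha> \<beta> S"
  have Z: "partition_sum n \<alpha> \<beta> > 0" using partition_sum_pos assms by simp
  have D: "\<alpha> + \<beta> + (real n - 1) * \<alpha> * \<beta> > 0"
    using assms by (intro add_pos_nonneg) auto
  have "(\<alpha> + \<beta> + (real n - 1) * \<alpha> * \<beta>) * ?W = \<alpha> * (1 + (real n - real i) * \<beta>) * partition_sum n \<alpha> \<beta>"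
    using sum_diagonal_alpha[OF assms(3,4), of \<alpha> 1 \<beta>]
    by (simp add: refined_weight_def refined_partition_sum_def partition_sum_def)
  then have "?W / partition_sum n \<alpha> \<beta> =
      \<alpha> * (1 + (real n - real i) * \<beta>) / (\<alpha> + \<beta> + (real n - 1) * \<alpha> * \<beta>)"
    using Z D by (simp add: frac_eq_eq mult_ac)
  also have "\<alpha> * (1 + (real n - real i) * \<beta>) = \<alpha> * \<beta> * (real n - real i + inverse \<beta>)"
    using assms(2) by (simp add: algebra_simps)
  also have "\<alpha> + \<beta> + (real n - 1) * \<alpha> * \<beta> =
      \<alpha> * \<beta> * (real n + inverse \<alpha> + inverse \<beta> - 1)"
    using assms(1,2) by (simp add: algebra_simps)
  finally have eq: "?W / partition_sum n \<alpha> \<beta> =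
      (real n - real i + inverse \<beta>) / (real n + inverse \<alpha> + inverse \<beta> - 1)"
    using assms(1,2) by simp
  have "(\<Sum>S\<in>diagonal_alpha n i. pmf (finite_staircase_pmf n \<alpha> \<beta>) S) = ?W / partition_sum n \<alpha> \<beta>"
    unfolding sum_divide_distrib using assms(1,2)
    by (intro sum.cong) (auto simp: pmf_finite_staircase_pmf diagonal_alpha_def)
  with eq show ?thesis by simp
qed

text \<open>One statement for all ways in which parameters tend to infinity: \<open>f\<close> and \<open>g\<close> are the
  identity or a constant. The denominator can vanish in the limit only if \<open>n = 1\<close> and
  \<open>a = b = 0\<close>, the excluded case.\<close>

lemma prob_diagonal_alpha_limit:
  assumes lim: "\<exists>p. pmf_tendsto_at_top (\<lambda>t. finite_staircase_pmf n (f t) (g t)) p"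
    and pos: "\<And>t. t > 0 \<Longrightarrow> f t > 0 \<and> g t > 0"
    and a: "((\<lambda>t. inverse (f t)) \<longlongrightarrow> a) at_top" and b: "((\<lambda>t. inverse (g t)) \<longlongrightarrow> b) at_top"
    and i: "1 \<le> i" "i \<le> n" and nz: "real n + a + b - 1 \<noteq> 0"
  shows "measure_pmf.prob (pmf_limit (\<lambda>t. finite_staircase_pmf n (f t) (g t)))
      {S. S i (n + 1 - i) = Some AlphaSym} = (real n - real i + b) / (real n + a + b - 1)"
proof -
  obtain p where p: "pmf_tendsto_at_top (\<lambda>t. finite_staircase_pmf n (f t) (g t)) p"
    using lim by blast
  have tend: "((\<lambda>t. pmf (finite_staircase_pmf n (f t) (g t)) S) \<longlongrightarrow> pmf p S) at_top" for S
    using p by (simp add: pmf_tendsto_at_top_def)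
  have "pmf p S = 0" if "S \<notin> staircase_tableaux n" for S
  proof -
    have "\<forall>\<^sub>F t in at_top. pmf (finite_staircase_pmf n (f t) (g t)) S = 0"
      using eventually_gt_at_top[of 0]
      by eventually_elim (use pos that in \<open>simp add: pmf_finite_staircase_pmf\<close>)
    then have "((\<lambda>t. pmf (finite_staircase_pmf n (f t) (g t)) S) \<longlongrightarrow> 0) at_top"
      by (rule tendsto_eventually)
    with tend show ?thesis by (rule tendsto_unique[rotated]) simp
  qed
  then have prob: "measure_pmf.prob p {S. S i (n + 1 - i) = Some AlphaSym} =
      (\<Sum>S\<in>diagonal_alpha n i. pmf p S)"
    by (rule prob_on_tableaux)
  have "((\<lambda>t. (real n - real i + inverse (g t)) / (real n + inverse (f t) + inverse (g t) - 1))
      \<longlongrightarrow> (real n - real i + b) / (real n + a + b - 1)) at_top"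
    using nz by (intro tendsto_intros a b) auto
  moreover have "\<forall>\<^sub>F t in at_top.
      (real n - real i + inverse (g t)) / (real n + inverse (f t) + inverse (g t) - 1) =
      (\<Sum>S\<in>diagonal_alpha n i. pmf (finite_staircase_pmf n (f t) (g t)) S)"
    using eventually_gt_at_top[of 0]
  proof eventually_elim
    case (elim t)
    then show ?case using pos[of t] prob_diagonal_alpha_finite[of "f t" "g t" i n] i by simp
  qed
  ultimately have "((\<lambda>t. \<Sum>S\<in>diagonal_alpha n i. pmf (finite_staircase_pmf n (f t) (g t)) S)
      \<longlongrightarrow> (real n - real i + b) / (real n + a + b - 1)) at_top"
    by (rule Lim_transform_eventually)
  moreover have "((\<lambda>t. \<Sum>S\<in>diagonal_alpha n i. pmf (finite_staircase_pmf n (f t) (g t)) S)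
      \<longlongrightarrow> (\<Sum>S\<in>diagonal_alpha n i. pmf p S)) at_top"
    by (intro tendsto_sum tend)
  ultimately have "(real n - real i + b) / (real n + a + b - 1) = (\<Sum>S\<in>diagonal_alpha n i. pmf p S)"
    by (rule tendsto_unique[rotated]) simp
  then show ?thesis
    unfolding pmf_limit_eq[OF p] prob by simp
qed

theorem theorem7p1:
  fixes \<alpha> \<beta> :: ennreal and a b :: real and n i :: nat
  assumes "\<alpha> > 0" and "\<beta> > 0"
    and "a = enn2real (inverse \<alpha>)" and "b = enn2real (inverse \<beta>)"
    and "n \<ge> 1" and "\<alpha> = \<infinity> \<and> \<beta> = \<infinity> \<Longrightarrow> n \<ge> 2"
    and "1 \<le> i" and "i \<le> n"
  shows "measure_pmf.prob (staircase_pmf n \<alpha> \<beta>) {S. S i (n + 1 - i) = Some AlphaSym} =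
    (real n - real i + b) / (real n + a + b - 1)"
proof -
  have inv0: "((\<lambda>t::real. inverse t) \<longlongrightarrow> 0) at_top"
    by (rule tendsto_inverse_0_at_top[OF filterlim_ident])
  have fin: "0 < enn2real y \<and> enn2real (inverse y) = inverse (enn2real y)"
    if "0 < y" "y \<noteq> \<infinity>" for y
    using that by (cases y) (auto simp: inverse_ennreal)
  consider "\<alpha> = \<infinity>" "\<beta> = \<infinity>" | "\<alpha> = \<infinity>" "\<beta> \<noteq> \<infinity>" | "\<alpha> \<noteq> \<infinity>" "\<beta> = \<infinity>"
    | "\<alpha> \<noteq> \<infinity>" "\<beta> \<noteq> \<infinity>" by blast
  then show ?thesis
  proof cases
    case 1
    then have ab: "a = 0" "b = 0" "n \<ge> 2" using assms by auto
    have "staircase_pmf n \<alpha> \<beta> = pmf_limit (\<lambda>t. finite_staircase_pmf n t t)"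
      using 1 by (simp add: staircase_pmf_def)
    then show ?thesis
      using prob_diagonal_alpha_limit[OF staircase_pmf_limits(1) _ inv0 inv0 assms(7,8)] ab by simp
  next
    case 2
    then have ab: "a = 0" "b = inverse (enn2real \<beta>)" and pos: "enn2real \<beta> > 0"
      using assms fin by auto
    have "inverse (enn2real \<beta>) > 0" using pos by simp
    then have nz: "real n + 0 + inverse (enn2real \<beta>) - 1 \<noteq> 0" using assms(5) by linarith
    have "staircase_pmf n \<alpha> \<beta> = pmf_limit (\<lambda>t. finite_staircase_pmf n t (enn2real \<beta>))"
      using 2 by (simp add: staircase_pmf_def)
    then show ?thesis
      using prob_diagonal_alpha_limit[OF staircase_pmf_limits(2)[OF pos] _ inv0 tendsto_const
          assms(7,8) nz] pos ab by simp
  next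
    case 3
    then have ab: "a = inverse (enn2real \<alpha>)" "b = 0" and pos: "enn2real \<alpha> > 0"
      using assms fin by auto
    have "inverse (enn2real \<alpha>) > 0" using pos by simp
    then have nz: "real n + inverse (enn2real \<alpha>) + 0 - 1 \<noteq> 0" using assms(5) by linarith
    have "staircase_pmf n \<alpha> \<beta> = pmf_limit (\<lambda>t. finite_staircase_pmf n (enn2real \<alpha>) t)"
      using 3 by (simp add: staircase_pmf_def)
    then show ?thesis
      using prob_diagonal_alpha_limit[OF staircase_pmf_limits(3)[OF pos] _ tendsto_const inv0
          assms(7,8) nz] pos ab by simp
  next
    case 4
    then have ab: "a = inverse (enn2real \<alpha>)" "b = inverse (enn2real \<beta>)"
      and pos: "enn2real \<alpha> > 0" "enn2real \<beta> > 0"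
      using assms fin by auto
    have "staircase_pmf n \<alpha> \<beta> = finite_staircase_pmf n (enn2real \<alpha>) (enn2real \<beta>)"
      using 4 by (simp add: staircase_pmf_def)
    then have "measure_pmf.prob (staircase_pmf n \<alpha> \<beta>) {S. S i (n + 1 - i) = Some AlphaSym} =
        (\<Sum>S\<in>diagonal_alpha n i. pmf (finite_staircase_pmf n (enn2real \<alpha>) (enn2real \<beta>)) S)"
      using prob_on_tableaux[of n] pos by (simp add: pmf_finite_staircase_pmf)
    then show ?thesis
      unfolding ab by (simp only: prob_diagonal_alpha_finite[OF pos assms(7,8)])
  qed
qed

end
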